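(* Let $f$ be a regular endomorphism of the countable universal bipartite graph $B$. (i) If the image of $f$ is infinite, then the $\mathscr{D}$-class of $f$ contains $2^{\aleph_0}$ many $\mathscr{L}$-classes and $2^{\aleph_0}$ many $\mathscr{R}$-classes. (ii) If the image of $f$ is finite but not isomorphic to $K_{1,1}$, then the $\mathscr{D}$-class of $f$ contains $\aleph_0$ many $\mathscr{L}$-classes and $2^{\aleph_0}$ many $\mathscr{R}$-classes. (iii) If $\operatorname{im} f\cong K_{1,1}$, then the $\mathscr{D}$-class of $f$ contains $\aleph_0$ many $\mathscr{L}$-classes and one $\mathscr{R}$-class.
   Context: A bipartite graph is a relational structure $(V,E,P)$ where $E$ is an irreflexive symmetric binary relation on $V$, $P=(V_0\times V_0)\cup(V_1\times V_1)$ for some partition $V=V_0\,\dot\cup\,V_1$, and $(u,v)\in E$ implies $(u,v)\notin P$; homomorphisms preserve $E$ and $P$. The countable universal bipartite graph $B$ is the Fraïssé limit of the finite bipartite graphs in this sense; $\operatorname{End} B$ is its endomorphism monoid. For $f\in\operatorname{End} B$ with $B=(V,E,P)$, $\operatorname{im} f=(Vf,Ef,P\cap(Vf\times Vf))$. $K_{1,1}$ is the bipartite graph with one vertex in each part joined by an edge. Green's relations on a monoid $M$: $f\,\mathscr{L}\,g$ iff $Mf=Mg$; $f\,\mathscr{R}\,g$ iff $fM=gM$; $\mathscr{D}=\mathscr{L}\circ\mathscr{R}$. An element $f$ is regular if $fgf=f$ for some $g\in M$. *)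

theory Defs
  imports "HOL-Algebra.Coset" "HOL-Library.Equipollence"
begin

record 'a bstruct =
  verts :: "'a set"
  edges :: "('a \<times> 'a) set"
  parts :: "('a \<times> 'a) set"

definition is_bstruct :: "'a bstruct \<Rightarrow> bool" where
  "is_bstruct A \<longleftrightarrow> edges A \<subseteq> verts A \<times> verts A \<and> parts A \<subseteq> verts A \<times> verts A"

text \<open>One of the two parts may be empty; otherwise the class of finite bipartite graphs would not be
  closed under induced substructures.\<close>

definition bipartite_graph :: "'a bstruct \<Rightarrow> bool" where
  "bipartite_graph A \<longleftrightarrow>
     is_bstruct A \<and> irrefl (edges A) \<and> sym (edges A) \<and>
     (\<exists>V0 V1. V0 \<union> V1 = verts A \<and> V0 \<inter> V1 = {} \<and> parts A = (V0 \<times> V0) \<union> (V1 \<times> V1)) \<and>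
     (\<forall>u v. (u, v) \<in> edges A \<longrightarrow> (u, v) \<notin> parts A)"

definition bhom :: "('a \<Rightarrow> 'b) \<Rightarrow> 'a bstruct \<Rightarrow> 'b bstruct \<Rightarrow> bool" where
  "bhom f A B \<longleftrightarrow>
     f ` verts A \<subseteq> verts B \<and>
     (\<forall>u v. (u, v) \<in> edges A \<longrightarrow> (f u, f v) \<in> edges B) \<and>
     (\<forall>u v. (u, v) \<in> parts A \<longrightarrow> (f u, f v) \<in> parts B)"

definition bembedding :: "('a \<Rightarrow> 'b) \<Rightarrow> 'a bstruct \<Rightarrow> 'b bstruct \<Rightarrow> bool" where
  "bembedding f A B \<longleftrightarrow>
     inj_on f (verts A) \<and> f ` verts A \<subseteq> verts B \<and>
     (\<forall>u\<in>verts A. \<forall>v\<in>verts A. (u, v) \<in> edges A \<longleftrightarrow> (f u, f v) \<in> edges B) \<and>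
     (\<forall>u\<in>verts A. \<forall>v\<in>verts A. (u, v) \<in> parts A \<longleftrightarrow> (f u, f v) \<in> parts B)"

definition biso :: "('a \<Rightarrow> 'b) \<Rightarrow> 'a bstruct \<Rightarrow> 'b bstruct \<Rightarrow> bool" where
  "biso f A B \<longleftrightarrow> bembedding f A B \<and> f ` verts A = verts B"

definition bisomorphic :: "'a bstruct \<Rightarrow> 'b bstruct \<Rightarrow> bool" where
  "bisomorphic A B \<longleftrightarrow> (\<exists>f. biso f A B)"

definition binduced :: "'a bstruct \<Rightarrow> 'a set \<Rightarrow> 'a bstruct" where
  "binduced A S = \<lparr>verts = S, edges = edges A \<inter> S \<times> S, parts = parts A \<inter> S \<times> S\<rparr>"

text \<open>Every finite structure has an isomorphic copy on natural numbers, so classes of finite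
  structures closed under isomorphism are represented by their members with vertices in \<^typ>\<open>nat\<close>.\<close>

definition age :: "'a bstruct \<Rightarrow> nat bstruct set" where
  "age B = {A. is_bstruct A \<and> finite (verts A) \<and> (\<exists>e. bembedding e A B)}"

definition homogeneous :: "'a bstruct \<Rightarrow> bool" where
  "homogeneous B \<longleftrightarrow>
     (\<forall>S T p. finite S \<and> S \<subseteq> verts B \<and> T \<subseteq> verts B \<and> biso p (binduced B S) (binduced B T) \<longrightarrow>
        (\<exists>\<alpha>. biso \<alpha> B B \<and> (\<forall>x\<in>S. \<alpha> x = p x)))"

definition fraisse_limit :: "nat bstruct set \<Rightarrow> 'a bstruct \<Rightarrow> bool" where
  "fraisse_limit K B \<longleftrightarrow>
     is_bstruct B \<and> countable (verts B) \<and> homogeneous B \<and> age B = K"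

definition universal_bipartite_graph :: "'a bstruct \<Rightarrow> bool" where
  "universal_bipartite_graph B \<longleftrightarrow>
     fraisse_limit {A. bipartite_graph A \<and> finite (verts A)} B"

definition K11 :: "nat bstruct" where
  "K11 = \<lparr>verts = {0, 1}, edges = {(0, 1), (1, 0)}, parts = {(0, 0), (1, 1)}\<rparr>"

definition bimage :: "'a bstruct \<Rightarrow> ('a \<Rightarrow> 'a) \<Rightarrow> 'a bstruct" where
  "bimage B f =
     \<lparr>verts = f ` verts B,
      edges = {(f u, f v) | u v. (u, v) \<in> edges B},
      parts = parts B \<inter> (f ` verts B) \<times> (f ` verts B)\<rparr>"

text \<open>Maps act on the right: the product \<open>f g\<close> means first \<open>f\<close>, then \<open>g\<close>. Endomorphisms are
  made extensional so that equal maps on the vertices are equal elements of the monoid.\<close>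

definition End_monoid :: "'a bstruct \<Rightarrow> ('a \<Rightarrow> 'a) monoid" where
  "End_monoid B =
     \<lparr>carrier = {f \<in> extensional (verts B). bhom f B B},
      mult = (\<lambda>f g. compose (verts B) g f),
      one = (\<lambda>x\<in>verts B. x)\<rparr>"

lemma monoid_End_monoid:
  assumes "is_bstruct B"
  shows "monoid (End_monoid B)"
proof -
  have V: "(u, v) \<in> edges B \<Longrightarrow> u \<in> verts B \<and> v \<in> verts B"
    "(u, v) \<in> parts B \<Longrightarrow> u \<in> verts B \<and> v \<in> verts B" for u v
    using assms unfolding is_bstruct_def by blast+
  have closed: "compose (verts B) g f \<in> {f \<in> extensional (verts B). bhom f B B}"
    if "bhom f B B" "bhom g B B" for f g
    using that unfolding bhom_def by (auto simp: compose_def image_subset_iff dest: V)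
  have one: "(\<lambda>x\<in>verts B. x) \<in> {f \<in> extensional (verts B). bhom f B B}"
    unfolding bhom_def by (auto dest: V)
  show ?thesis
  proof (rule monoidI)
    show "f \<otimes>\<^bsub>End_monoid B\<^esub> g \<otimes>\<^bsub>End_monoid B\<^esub> h
        = f \<otimes>\<^bsub>End_monoid B\<^esub> (g \<otimes>\<^bsub>End_monoid B\<^esub> h)"
      if "f \<in> carrier (End_monoid B)" for f g h
      using that by (intro ext) (simp add: End_monoid_def bhom_def compose_def image_subset_iff)
    show "\<one>\<^bsub>End_monoid B\<^esub> \<otimes>\<^bsub>End_monoid B\<^esub> f = f"
      if "f \<in> carrier (End_monoid B)" for f
      using that by (intro ext) (simp add: End_monoid_def compose_def extensional_def)
    show "f \<otimes>\<^bsub>End_monoid B\<^esub> \<one>\<^bsub>End_monoid B\<^esub> = f"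
      if "f \<in> carrier (End_monoid B)" for f
      using that
      by (intro ext) (simp add: End_monoid_def bhom_def compose_def extensional_def image_subset_iff)
  qed (use closed one in \<open>auto simp: End_monoid_def\<close>)
qed

definition green_L :: "('a, 'b) monoid_scheme \<Rightarrow> ('a \<times> 'a) set" where
  "green_L M = {(f, g). f \<in> carrier M \<and> g \<in> carrier M \<and>
     carrier M #>\<^bsub>M\<^esub> f = carrier M #>\<^bsub>M\<^esub> g}"

definition green_R :: "('a, 'b) monoid_scheme \<Rightarrow> ('a \<times> 'a) set" where
  "green_R M = {(f, g). f \<in> carrier M \<and> g \<in> carrier M \<and>
     f <#\<^bsub>M\<^esub> carrier M = g <#\<^bsub>M\<^esub> carrier M}"

definition green_D :: "('a, 'b) monoid_scheme \<Rightarrow> ('a \<times> 'a) set" where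
  "green_D M = green_L M O green_R M"

definition D_class :: "('a, 'b) monoid_scheme \<Rightarrow> 'a \<Rightarrow> 'a set" where
  "D_class M f = green_D M `` {f}"

definition L_classes_in :: "('a, 'b) monoid_scheme \<Rightarrow> 'a set \<Rightarrow> 'a set set" where
  "L_classes_in M D = {C \<in> carrier M // green_L M. C \<subseteq> D}"

definition R_classes_in :: "('a, 'b) monoid_scheme \<Rightarrow> 'a set \<Rightarrow> 'a set set" where
  "R_classes_in M D = {C \<in> carrier M // green_R M. C \<subseteq> D}"

definition regular_element :: "('a, 'b) monoid_scheme \<Rightarrow> 'a \<Rightarrow> bool" where
  "regular_element M f \<longleftrightarrow>
     f \<in> carrier M \<and> (\<exists>g\<in>carrier M. f \<otimes>\<^bsub>M\<^esub> g \<otimes>\<^bsub>M\<^esub> f = f)"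

end

theory Submission
  imports Defs
begin

text \<open>A regular \<open>f\<close> has a section \<open>g\<close> on its image \<open>\<Gamma>\<close>, so \<open>\<Gamma>\<close> is a retract of \<open>B\<close> and therefore
  algebraically closed: every finite subset of one part of \<open>\<Gamma>\<close> has a common neighbour in \<open>\<Gamma>\<close>.
  Every countable bipartite graph \<open>\<Delta>\<close> embeds into \<open>B\<close> in such a way that each vertex outside the
  copy has only finitely many neighbours in it, and then every colour-preserving homomorphism
  \<open>\<Delta> \<rightarrow> \<Gamma>\<close> extends to \<open>B \<rightarrow> \<Gamma>\<close>, one vertex at a time. Take for \<open>\<Delta>\<close> the graph \<open>\<Gamma>\<close> with every vertex
  repeated infinitely often, plus infinitely many isolated vertices. Choosing one copy of each vertex
  of \<open>\<Gamma>\<close> gives maps in the R-class of \<open>f\<close> whose images differ, hence many L-classes. Sending the isolated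
  vertices independently to two vertices of \<open>\<Gamma>\<close> in the same part gives maps in the L-class of \<open>f\<close>
  whose kernels differ, hence many R-classes; two such vertices exist unless \<open>\<Gamma>\<close> is a single edge.\<close>

section \<open>Green's relations in a monoid\<close>

context monoid
begin

lemma green_L_iff:
  "(f, g) \<in> green_L G \<longleftrightarrow> f \<in> carrier G \<and> g \<in> carrier G \<and>
     (\<exists>m\<in>carrier G. f = m \<otimes> g) \<and> (\<exists>n\<in>carrier G. g = n \<otimes> f)"
proof -
  have sub: "carrier G #> f \<subseteq> carrier G #> g \<longleftrightarrow> (\<exists>m\<in>carrier G. f = m \<otimes> g)"
    if "f \<in> carrier G" "g \<in> carrier G" for f g
  proof
    assume "carrier G #> f \<subseteq> carrier G #> g"
    moreover have "f \<in> carrier G #> f" using that l_one[of f] one_closed unfolding r_coset_def by blast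
    ultimately show "\<exists>m\<in>carrier G. f = m \<otimes> g" unfolding r_coset_def by auto
  next
    assume "\<exists>m\<in>carrier G. f = m \<otimes> g"
    then show "carrier G #> f \<subseteq> carrier G #> g"
      using that unfolding r_coset_def by (auto simp flip: m_assoc)
  qed
  show ?thesis using sub[of f g] sub[of g f] unfolding green_L_def by blast
qed

lemma green_R_iff:
  "(f, g) \<in> green_R G \<longleftrightarrow> f \<in> carrier G \<and> g \<in> carrier G \<and>
     (\<exists>m\<in>carrier G. f = g \<otimes> m) \<and> (\<exists>n\<in>carrier G. g = f \<otimes> n)"
proof -
  have sub: "f <# carrier G \<subseteq> g <# carrier G \<longleftrightarrow> (\<exists>m\<in>carrier G. f = g \<otimes> m)"
    if "f \<in> carrier G" "g \<in> carrier G" for f g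
  proof
    assume "f <# carrier G \<subseteq> g <# carrier G"
    moreover have "f \<in> f <# carrier G" using that r_one[of f] one_closed unfolding l_coset_def by blast
    ultimately show "\<exists>m\<in>carrier G. f = g \<otimes> m" unfolding l_coset_def by auto
  next
    assume "\<exists>m\<in>carrier G. f = g \<otimes> m"
    then show "f <# carrier G \<subseteq> g <# carrier G"
      using that unfolding l_coset_def by (auto simp: m_assoc)
  qed
  show ?thesis using sub[of f g] sub[of g f] unfolding green_R_def by blast
qed

lemma equiv_green_L: "equiv (carrier G) (green_L G)"
proof (rule equivI)
  show "green_L G \<subseteq> carrier G \<times> carrier G" by (auto simp: green_L_def)
  show "refl_on (carrier G) (green_L G)" by (simp add: green_L_def refl_on_def)
  show "sym (green_L G)" by (rule symI) (simp add: green_L_def)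
  show "trans (green_L G)" by (rule transI) (simp add: green_L_def)
qed

lemma equiv_green_R: "equiv (carrier G) (green_R G)"
proof (rule equivI)
  show "green_R G \<subseteq> carrier G \<times> carrier G" by (auto simp: green_R_def)
  show "refl_on (carrier G) (green_R G)" by (simp add: green_R_def refl_on_def)
  show "sym (green_R G)" by (rule symI) (simp add: green_R_def)
  show "trans (green_R G)" by (rule transI) (simp add: green_R_def)
qed

text \<open>Commutation lets a D-class be entered through either the L-class or the R-class of
  \<open>f\<close>, so that both kinds of classes can be counted by representatives.\<close>

lemma green_L_R_commute: "green_L G O green_R G = green_R G O green_L G"
proof (intro subset_antisym subrelI)
  fix f h assume "(f, h) \<in> green_L G O green_R G"
  then obtain k where "(f, k) \<in> green_L G" "(k, h) \<in> green_R G" by blast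
  then obtain n m v w where c: "f \<in> carrier G" "k \<in> carrier G" "h \<in> carrier G"
      "n \<in> carrier G" "m \<in> carrier G" "v \<in> carrier G" "w \<in> carrier G"
    and e: "f = n \<otimes> k" "k = m \<otimes> f" "h = k \<otimes> v" "k = h \<otimes> w"
    unfolding green_L_iff green_R_iff by blast
  \<comment> \<open>If \<open>f\<close> is L-related to \<open>k\<close> and right multiplication by
    \<open>v\<close> carries \<open>k\<close> to \<open>h\<close> inside its R-class, then the same
    multiplication carries \<open>f\<close> to an element completing the square. The converse
    inclusion uses left multiplication in the same way.\<close>
  have "f = (f \<otimes> v) \<otimes> w" "f \<otimes> v = n \<otimes> h" "h = m \<otimes> (f \<otimes> v)"
    using c e by (metis m_assoc m_closed)+
  then have "(f, f \<otimes> v) \<in> green_R G" "(f \<otimes> v, h) \<in> green_L G"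
    using c unfolding green_L_iff green_R_iff by blast+
  then show "(f, h) \<in> green_R G O green_L G" by blast
next
  fix f h assume "(f, h) \<in> green_R G O green_L G"
  then obtain k where "(f, k) \<in> green_R G" "(k, h) \<in> green_L G" by blast
  then obtain n m v w where c: "f \<in> carrier G" "k \<in> carrier G" "h \<in> carrier G"
      "n \<in> carrier G" "m \<in> carrier G" "v \<in> carrier G" "w \<in> carrier G"
    and e: "f = k \<otimes> n" "k = f \<otimes> m" "h = v \<otimes> k" "k = w \<otimes> h"
    unfolding green_L_iff green_R_iff by blast
  have "f = w \<otimes> (v \<otimes> f)" "v \<otimes> f = h \<otimes> n" "h = (v \<otimes> f) \<otimes> m"
    using c e by (metis m_assoc m_closed)+
  then have "(f, v \<otimes> f) \<in> green_L G" "(v \<otimes> f, h) \<in> green_R G"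
    using c unfolding green_L_iff green_R_iff by blast+
  then show "(f, h) \<in> green_L G O green_R G" by blast
qed

section \<open>Representatives for the classes inside a D-class\<close>

text \<open>Since D is also R followed by L, every L-class inside the D-class meets the R-class of
  \<open>f\<close>. Counting L-classes thus reduces to separating elements of a single R-class; the
  dual statement follows.\<close>

lemma L_classes_in_D_class:
  assumes "f \<in> carrier G"
  shows "L_classes_in G (D_class G f) = (\<lambda>k. green_L G `` {k}) ` {k. (f, k) \<in> green_R G}"
proof -
  have D: "D_class G f = (green_R G O green_L G) `` {f}"
    unfolding D_class_def green_D_def green_L_R_commute ..
  show ?thesis
  proof (intro subset_antisym subsetI)
    fix C assume "C \<in> L_classes_in G (D_class G f)"
    then obtain h where h: "h \<in> carrier G" "C = green_L G `` {h}" "C \<subseteq> D_class G f"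
      unfolding L_classes_in_def quotient_def by blast
    then have "h \<in> D_class G f" using equiv_class_self[OF equiv_green_L] by blast
    then obtain k where "(f, k) \<in> green_R G" "(k, h) \<in> green_L G" unfolding D by blast
    then show "C \<in> (\<lambda>k. green_L G `` {k}) ` {k. (f, k) \<in> green_R G}"
      using equiv_class_eq[OF equiv_green_L] h by blast
  next
    fix C assume "C \<in> (\<lambda>k. green_L G `` {k}) ` {k. (f, k) \<in> green_R G}"
    then obtain k where "C = green_L G `` {k}" "(f, k) \<in> green_R G" "k \<in> carrier G"
      unfolding green_R_iff by blast
    then show "C \<in> L_classes_in G (D_class G f)"
      unfolding L_classes_in_def quotient_def D by blast
  qed
qed

lemma R_classes_in_D_class:
  assumes "f \<in> carrier G"
  shows "R_classes_in G (D_class G f) = (\<lambda>k. green_R G `` {k}) ` {k. (f, k) \<in> green_L G}"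
proof (intro subset_antisym subsetI)
  fix C assume "C \<in> R_classes_in G (D_class G f)"
  then obtain h where h: "h \<in> carrier G" "C = green_R G `` {h}" "C \<subseteq> D_class G f"
    unfolding R_classes_in_def quotient_def by blast
  then have "h \<in> D_class G f" using equiv_class_self[OF equiv_green_R] by blast
  then obtain k where "(f, k) \<in> green_L G" "(k, h) \<in> green_R G"
    unfolding D_class_def green_D_def by blast
  then show "C \<in> (\<lambda>k. green_R G `` {k}) ` {k. (f, k) \<in> green_L G}"
    using equiv_class_eq[OF equiv_green_R] h by blast
next
  fix C assume "C \<in> (\<lambda>k. green_R G `` {k}) ` {k. (f, k) \<in> green_L G}"
  then obtain k where "C = green_R G `` {k}" "(f, k) \<in> green_L G" "k \<in> carrier G"
    unfolding green_L_iff by blast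
  then show "C \<in> R_classes_in G (D_class G f)"
    unfolding R_classes_in_def quotient_def D_class_def green_D_def by blast
qed

lemma lepoll_L_classes_in_D_class:
  assumes "f \<in> carrier G" "\<And>s. s \<in> I \<Longrightarrow> (f, k s) \<in> green_R G"
    and "\<And>s t. s \<in> I \<Longrightarrow> t \<in> I \<Longrightarrow> (k s, k t) \<in> green_L G \<Longrightarrow> s = t"
  shows "I \<lesssim> L_classes_in G (D_class G f)"
  unfolding lepoll_def
proof (intro exI conjI)
  show "inj_on (\<lambda>s. green_L G `` {k s}) I"
    using assms(2,3) by (intro inj_onI) (metis eq_equiv_class[OF _ equiv_green_L] green_R_iff)
  show "(\<lambda>s. green_L G `` {k s}) ` I \<subseteq> L_classes_in G (D_class G f)"
    using assms(2) unfolding L_classes_in_D_class[OF assms(1)] by blast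
qed

lemma lepoll_R_classes_in_D_class:
  assumes "f \<in> carrier G" "\<And>s. s \<in> I \<Longrightarrow> (f, k s) \<in> green_L G"
    and "\<And>s t. s \<in> I \<Longrightarrow> t \<in> I \<Longrightarrow> (k s, k t) \<in> green_R G \<Longrightarrow> s = t"
  shows "I \<lesssim> R_classes_in G (D_class G f)"
  unfolding lepoll_def
proof (intro exI conjI)
  show "inj_on (\<lambda>s. green_R G `` {k s}) I"
    using assms(2,3) by (intro inj_onI) (metis eq_equiv_class[OF _ equiv_green_R] green_L_iff)
  show "(\<lambda>s. green_R G `` {k s}) ` I \<subseteq> R_classes_in G (D_class G f)"
    using assms(2) unfolding R_classes_in_D_class[OF assms(1)] by blast
qed

lemma L_classes_in_lepoll_carrier: "L_classes_in G D \<lesssim> carrier G"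
proof (rule lepoll_trans[OF subset_imp_lepoll])
  show "L_classes_in G D \<subseteq> (\<lambda>k. green_L G `` {k}) ` carrier G"
    unfolding L_classes_in_def quotient_def by blast
qed (rule image_lepoll)

lemma R_classes_in_lepoll_carrier: "R_classes_in G D \<lesssim> carrier G"
proof (rule lepoll_trans[OF subset_imp_lepoll])
  show "R_classes_in G D \<subseteq> (\<lambda>k. green_R G `` {k}) ` carrier G"
    unfolding R_classes_in_def quotient_def by blast
qed (rule image_lepoll)

end

section \<open>The extension property of the universal bipartite graph\<close>

text \<open>The two parts are encoded by a colouring with values in \<open>bool\<close>, and
  homogeneity together with the age is replaced by the one-point extension property, the form in
  which all later constructions use it. \<open>W\<close> may contain points outside the
  graph.\<close>

locale generic_bipartite =
  fixes B :: "'v bstruct" and c :: "'v \<Rightarrow> bool"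
  assumes countable_verts: "countable (verts B)"
    and edges_verts: "(u, v) \<in> edges B \<Longrightarrow> u \<in> verts B \<and> v \<in> verts B"
    and edges_sym: "(u, v) \<in> edges B \<Longrightarrow> (v, u) \<in> edges B"
    and edges_colour: "(u, v) \<in> edges B \<Longrightarrow> c u \<noteq> c v"
    and parts_iff: "(u, v) \<in> parts B \<longleftrightarrow> u \<in> verts B \<and> v \<in> verts B \<and> c u = c v"
    and extension: "\<lbrakk>finite U; finite W; U \<subseteq> verts B; U \<inter> W = {}; \<And>u. u \<in> U \<Longrightarrow> c u \<noteq> b\<rbrakk> \<Longrightarrow>
      \<exists>x\<in>verts B. x \<notin> W \<and> c x = b \<and> (\<forall>u\<in>U. (x, u) \<in> edges B) \<and> (\<forall>w\<in>W. (x, w) \<notin> edges B)"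

text \<open>The age consists of structures on natural numbers, so the induced subgraph is first
  copied along an enumeration \<open>q\<close> of the vertices. The copy embeds back by
  \<open>e\<close>, hence lies in the age and is bipartite, and bipartiteness is then pulled back
  along \<open>q\<close>.\<close>

lemma universal_bipartite_graph_finite_induced:
  assumes B: "universal_bipartite_graph B" and S: "finite S" "S \<subseteq> verts B"
  shows "bipartite_graph (binduced B S)"
proof -
  define q where "q = to_nat_on (verts B)"
  define e where "e = inv_into (verts B) q"
  have cV: "countable (verts B)" and age: "age B = {A. bipartite_graph A \<and> finite (verts A)}"
    using B unfolding universal_bipartite_graph_def fraisse_limit_def by auto
  have q: "inj_on q (verts B)" unfolding q_def using cV by (rule inj_on_to_nat_on)
  have eq: "e (q x) = x" if "x \<in> S" for x
    unfolding e_def using q S that by (simp add: inv_into_f_f subset_iff)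
  define A where "A = \<lparr>verts = q ` S, edges = {(i, j). i \<in> q ` S \<and> j \<in> q ` S \<and> (e i, e j) \<in> edges B},
     parts = {(i, j). i \<in> q ` S \<and> j \<in> q ` S \<and> (e i, e j) \<in> parts B}\<rparr>"
  have "bembedding e A B"
    unfolding bembedding_def A_def using S by (auto simp: eq inj_on_def)
  then have "A \<in> age B" unfolding age_def is_bstruct_def by (auto simp: A_def S)
  then have A: "bipartite_graph A" using age by blast
  then obtain V0 V1 where V01: "V0 \<union> V1 = verts A" "V0 \<inter> V1 = {}"
     "parts A = (V0 \<times> V0) \<union> (V1 \<times> V1)" unfolding bipartite_graph_def by blast
  have E: "(u, v) \<in> edges B \<longleftrightarrow> (q u, q v) \<in> edges A"
    and P: "(u, v) \<in> parts B \<longleftrightarrow> (q u, q v) \<in> parts A" if "u \<in> S" "v \<in> S" for u v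
    using that by (auto simp: A_def eq)
  show ?thesis
    unfolding bipartite_graph_def
  proof (intro conjI)
    show "is_bstruct (binduced B S)" unfolding is_bstruct_def binduced_def by auto
    show "irrefl (edges (binduced B S))" "sym (edges (binduced B S))"
      "\<forall>u v. (u, v) \<in> edges (binduced B S) \<longrightarrow> (u, v) \<notin> parts (binduced B S)"
      using A unfolding bipartite_graph_def binduced_def irrefl_def sym_def by (auto simp: E P)
    show "\<exists>V0 V1. V0 \<union> V1 = verts (binduced B S) \<and> V0 \<inter> V1 = {} \<and>
        parts (binduced B S) = V0 \<times> V0 \<union> V1 \<times> V1"
    proof (intro exI conjI)
      show "{x \<in> S. q x \<in> V0} \<union> {x \<in> S. q x \<in> V1} = verts (binduced B S)"
        using V01(1) by (auto simp: binduced_def A_def)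
      show "{x \<in> S. q x \<in> V0} \<inter> {x \<in> S. q x \<in> V1} = {}" using V01(2) by blast
      show "parts (binduced B S) = {x \<in> S. q x \<in> V0} \<times> {x \<in> S. q x \<in> V0} \<union>
          {x \<in> S. q x \<in> V1} \<times> {x \<in> S. q x \<in> V1}"
      proof (rule Set.set_eqI)
        fix z :: "'a \<times> 'a"
        obtain u v where z: "z = (u, v)" by (cases z)
        have "z \<in> parts (binduced B S) \<longleftrightarrow> u \<in> S \<and> v \<in> S \<and> (q u, q v) \<in> V0 \<times> V0 \<union> V1 \<times> V1"
          using P[of u v] unfolding V01(3) binduced_def z by auto
        then show "z \<in> parts (binduced B S) \<longleftrightarrow> z \<in> {x \<in> S. q x \<in> V0} \<times> {x \<in> S. q x \<in> V0} \<union>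
            {x \<in> S. q x \<in> V1} \<times> {x \<in> S. q x \<in> V1}"
          unfolding z by blast
      qed
    qed
  qed
qed

text \<open>For the extension property, a finite induced subgraph is enlarged by one abstract vertex
  with the prescribed colour and neighbours. The enlarged graph lies in the age and so embeds into
  \<open>B\<close>; by homogeneity an automorphism matches the original subgraph with its embedded
  copy, and the preimage of the new vertex is the required one.\<close>

lemma universal_bipartite_graph_imp_generic:
  assumes B: "universal_bipartite_graph B"
  obtains c where "generic_bipartite B c"
proof -
  have str: "is_bstruct B" and cV: "countable (verts B)" and hom: "homogeneous B"
    and age: "age B = {A. bipartite_graph A \<and> finite (verts A)}"
    using B unfolding universal_bipartite_graph_def fraisse_limit_def by auto
  have EV: "(u, v) \<in> edges B \<Longrightarrow> u \<in> verts B \<and> v \<in> verts B"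
    and PV: "(u, v) \<in> parts B \<Longrightarrow> u \<in> verts B \<and> v \<in> verts B" for u v
    using str unfolding is_bstruct_def by auto
  \<comment> \<open>Bipartiteness is available only for finite induced subgraphs, so the global
    axioms are verified on sets of at most three vertices.\<close>
  have loc: "\<exists>V0. (\<forall>u\<in>S. \<forall>v\<in>S. (u, v) \<in> parts B \<longleftrightarrow> (u \<in> V0 \<longleftrightarrow> v \<in> V0)) \<and>
      (\<forall>u\<in>S. \<forall>v\<in>S. (u, v) \<in> edges B \<longrightarrow> (v, u) \<in> edges B \<and> (u, v) \<notin> parts B)"
    if S: "finite S" "S \<subseteq> verts B" for S
  proof -
    have bg: "bipartite_graph (binduced B S)"
      by (rule universal_bipartite_graph_finite_induced[OF B S])
    then obtain V0 V1 where V01: "V0 \<union> V1 = S" "V0 \<inter> V1 = {}"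
      "parts B \<inter> S \<times> S = (V0 \<times> V0) \<union> (V1 \<times> V1)"
      unfolding bipartite_graph_def binduced_def by auto
    have "\<forall>u\<in>S. \<forall>v\<in>S. (u, v) \<in> parts B \<longleftrightarrow> (u \<in> V0 \<longleftrightarrow> v \<in> V0)"
    proof (intro ballI)
      fix u v assume uv: "u \<in> S" "v \<in> S"
      then have "(u, v) \<in> parts B \<longleftrightarrow> (u, v) \<in> (V0 \<times> V0) \<union> (V1 \<times> V1)"
        unfolding V01(3)[symmetric] by blast
      then show "(u, v) \<in> parts B \<longleftrightarrow> (u \<in> V0 \<longleftrightarrow> v \<in> V0)" using V01(1,2) uv by blast
    qed
    moreover have "\<forall>u\<in>S. \<forall>v\<in>S. (u, v) \<in> edges B \<longrightarrow> (v, u) \<in> edges B \<and> (u, v) \<notin> parts B"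
      using bg unfolding bipartite_graph_def binduced_def sym_def by auto
    ultimately show ?thesis by blast
  qed
  have "\<exists>V0 V1. V0 \<union> V1 = verts K11 \<and> V0 \<inter> V1 = {} \<and> parts K11 = V0 \<times> V0 \<union> V1 \<times> V1"
    by (rule exI[of _ "{0}"], rule exI[of _ "{1}"]) (auto simp: K11_def)
  then have "bipartite_graph K11"
    unfolding bipartite_graph_def is_bstruct_def irrefl_def sym_def by (auto simp: K11_def)
  then have "K11 \<in> age B" unfolding age by (simp add: K11_def)
  then obtain k where "bembedding k K11 B" unfolding age_def by blast
  then have "(k 0, k 1) \<in> edges B" unfolding bembedding_def K11_def by auto
  then obtain p0 p1 where p01: "(p0, p1) \<in> edges B" by blast
  then have pV: "p0 \<in> verts B" "p1 \<in> verts B" using EV by blast+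
  \<comment> \<open>The colour of \<open>v\<close> tells whether it lies in the part of
    \<open>p0\<close>. The edge from \<open>p0\<close> to \<open>p1\<close> ensures that both
    colours occur.\<close>
  define c where "c v = ((p0, v) \<in> parts B)" for v
  have P: "(u, v) \<in> parts B \<longleftrightarrow> u \<in> verts B \<and> v \<in> verts B \<and> c u = c v" for u v
  proof (cases "u \<in> verts B \<and> v \<in> verts B")
    case True
    then have "finite {p0, u, v}" "{p0, u, v} \<subseteq> verts B" using pV by auto
    from loc[OF this] obtain V0
      where "\<forall>x\<in>{p0, u, v}. \<forall>y\<in>{p0, u, v}. (x, y) \<in> parts B \<longleftrightarrow> (x \<in> V0 \<longleftrightarrow> y \<in> V0)" by blast
    then have "(u, v) \<in> parts B \<longleftrightarrow> (u \<in> V0 \<longleftrightarrow> v \<in> V0)" "c u \<longleftrightarrow> (p0 \<in> V0 \<longleftrightarrow> u \<in> V0)"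
      "c v \<longleftrightarrow> (p0 \<in> V0 \<longleftrightarrow> v \<in> V0)" unfolding c_def by blast+
    then show ?thesis using True by blast
  next
    case False
    then show ?thesis using PV by blast
  qed
  have E: "(v, u) \<in> edges B \<and> c u \<noteq> c v" if "(u, v) \<in> edges B" for u v
    using loc[of "{u, v}"] EV[OF that] that P[of u v] by auto
  have "\<exists>w. w \<in> verts B \<and> c w = b" for b
    using pV E[OF p01] by (cases "c p0 = b") auto
  then obtain w0 where w0: "\<And>b. w0 b \<in> verts B" "\<And>b. c (w0 b) = b" by metis
  have ext: "\<exists>x\<in>verts B. x \<notin> W \<and> c x = b \<and> (\<forall>u\<in>U. (x, u) \<in> edges B) \<and> (\<forall>w\<in>W. (x, w) \<notin> edges B)"
    if U: "finite U" "finite W" "U \<subseteq> verts B" "U \<inter> W = {}" "\<And>u. u \<in> U \<Longrightarrow> c u \<noteq> b" for U W b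
  proof -
    \<comment> \<open>The vertex \<open>w0 b\<close> is included so that the colour of the new
      vertex can be read off from the relation \<open>parts\<close> with a vertex known to have
      colour \<open>b\<close>.\<close>
    define S where "S = insert (w0 b) (U \<union> (W \<inter> verts B))"
    have S: "finite S" "S \<subseteq> verts B" "U \<subseteq> S" "w0 b \<in> S" using U w0 unfolding S_def by auto
    define q where "q = to_nat_on (verts B)"
    define r where "r = inv_into (verts B) q"
    have q: "inj_on q (verts B)" unfolding q_def using cV by (rule inj_on_to_nat_on)
    have rq: "r (q x) = x" if "x \<in> S" for x
      unfolding r_def using q S that by (simp add: inv_into_f_f subset_iff)
    obtain n where n: "n \<notin> q ` S" using ex_new_if_finite[of "q ` S"] S by auto
    have nq: "q x \<noteq> n" if "x \<in> S" for x using n that by auto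
    define d where "d i = (if i = n then b else c (r i))" for i
    \<comment> \<open>A copy of the subgraph induced on \<open>S\<close>, with an added vertex
      \<open>n\<close> of colour \<open>b\<close> whose neighbours are exactly the copies of the
      vertices in \<open>U\<close>.\<close>
    define A where "A = \<lparr>verts = insert n (q ` S),
      edges = {(q u, q v) | u v. u \<in> S \<and> v \<in> S \<and> (u, v) \<in> edges B} \<union> {n} \<times> (q ` U) \<union> (q ` U) \<times> {n},
      parts = {(i, j). i \<in> insert n (q ` S) \<and> j \<in> insert n (q ` S) \<and> d i = d j}\<rparr>"
    have dq: "d (q x) = c x" if "x \<in> S" for x using that nq rq by (simp add: d_def)
    have dn: "d n = b" by (simp add: d_def)
    have dE: "d i \<noteq> d j \<and> (j, i) \<in> edges A \<and> i \<in> verts A \<and> j \<in> verts A" if "(i, j) \<in> edges A" for i j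
    proof -
      consider u v where "i = q u" "j = q v" "u \<in> S" "v \<in> S" "(u, v) \<in> edges B"
        | u where "i = n" "j = q u" "u \<in> U" | u where "i = q u" "j = n" "u \<in> U"
        using \<open>(i, j) \<in> edges A\<close> unfolding A_def by auto
      then show ?thesis
      proof cases
        case 1
        then have "(v, u) \<in> edges B" "c u \<noteq> c v" using E by blast+
        then show ?thesis using 1 dq unfolding A_def by auto
      next
        case 2
        then have "u \<in> S" "c u \<noteq> b" using S(3) U(5) by auto
        then show ?thesis using 2 dq dn unfolding A_def by auto
      next
        case 3
        then have "u \<in> S" "c u \<noteq> b" using S(3) U(5) by auto
        then show ?thesis using 3 dq dn unfolding A_def by auto
      qed
    qed
    have "bipartite_graph A"
      unfolding bipartite_graph_def
    proof (intro conjI)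
      show "is_bstruct A" using dE unfolding is_bstruct_def by (auto simp: A_def)
      show "irrefl (edges A)" "sym (edges A)" using dE unfolding irrefl_def sym_def by blast+
      show "\<exists>V0 V1. V0 \<union> V1 = verts A \<and> V0 \<inter> V1 = {} \<and> parts A = V0 \<times> V0 \<union> V1 \<times> V1"
        by (rule exI[of _ "{i \<in> verts A. d i}"], rule exI[of _ "{i \<in> verts A. \<not> d i}"])
          (auto simp: A_def)
      show "\<forall>u v. (u, v) \<in> edges A \<longrightarrow> (u, v) \<notin> parts A" using dE by (auto simp: A_def)
    qed
    then have "A \<in> age B" unfolding age using S by (simp add: A_def)
    then obtain e where e: "bembedding e A B" unfolding age_def by blast
    have vA: "n \<in> verts A" "\<And>x. x \<in> S \<Longrightarrow> q x \<in> verts A" by (auto simp: A_def)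
    have e_inj: "e i = e j \<longleftrightarrow> i = j" and e_V: "e i \<in> verts B"
      and e_E: "(e i, e j) \<in> edges B \<longleftrightarrow> (i, j) \<in> edges A"
      and e_P: "(e i, e j) \<in> parts B \<longleftrightarrow> (i, j) \<in> parts A"
      if "i \<in> verts A" "j \<in> verts A" for i j
      using e that unfolding bembedding_def inj_on_def by blast+
    have q_inj: "q x = q y \<longleftrightarrow> x = y" if "x \<in> S" "y \<in> S" for x y
      using rq that by metis
    have A_E: "(q x, q y) \<in> edges A \<longleftrightarrow> (x, y) \<in> edges B" if "x \<in> S" "y \<in> S" for x y
      using that nq unfolding A_def by (auto simp: q_inj)
    have A_P: "(q x, q y) \<in> parts A \<longleftrightarrow> (x, y) \<in> parts B" if "x \<in> S" "y \<in> S" for x y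
      using that S unfolding A_def by (auto simp: dq P)
    have A_nE: "(n, q x) \<in> edges A \<longleftrightarrow> x \<in> U" if "x \<in> S" for x
      using that nq S(3) unfolding A_def by (auto simp: q_inj subset_iff)
    have A_nP: "(n, q x) \<in> parts A \<longleftrightarrow> c x = b" if "x \<in> S" for x
      using that unfolding A_def by (auto simp: dq dn)
    define p where "p x = e (q x)" for x
    have "biso p (binduced B S) (binduced B (p ` S))"
      unfolding biso_def bembedding_def binduced_def p_def inj_on_def
      by (auto simp: e_inj e_E e_P vA q_inj A_E A_P)
    moreover have "p ` S \<subseteq> verts B" unfolding p_def using e_V vA by blast
    ultimately obtain \<alpha> where \<alpha>: "biso \<alpha> B B" "\<And>x. x \<in> S \<Longrightarrow> \<alpha> x = p x"
      using hom[unfolded homogeneous_def, rule_format, of S "p ` S" p] S by blast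
    \<comment> \<open>The automorphism is onto, so the image \<open>e n\<close> of the added vertex
      can be pulled back; its relations to \<open>S\<close> are those of \<open>n\<close> to the
      copy of \<open>S\<close>.\<close>
    have "e n \<in> \<alpha> ` verts B" using \<alpha>(1) e_V[OF vA(1) vA(1)] unfolding biso_def by simp
    then obtain x where x: "x \<in> verts B" "\<alpha> x = e n" by auto
    have \<alpha>E: "(x, y) \<in> edges B \<longleftrightarrow> y \<in> U" and \<alpha>P: "(x, y) \<in> parts B \<longleftrightarrow> c y = b" if "y \<in> S" for y
    proof -
      have "(x, y) \<in> edges B \<longleftrightarrow> (\<alpha> x, \<alpha> y) \<in> edges B" "(x, y) \<in> parts B \<longleftrightarrow> (\<alpha> x, \<alpha> y) \<in> parts B"
        using \<alpha>(1) x S that unfolding biso_def bembedding_def by blast+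
      then show "(x, y) \<in> edges B \<longleftrightarrow> y \<in> U" "(x, y) \<in> parts B \<longleftrightarrow> c y = b"
        using that by (auto simp: \<alpha> x p_def e_E e_P vA A_nE A_nP)
    qed
    have "x \<notin> S"
    proof
      assume xS: "x \<in> S"
      then have "e (q x) = e n" using \<alpha>(2) x(2) unfolding p_def by simp
      then show False using e_inj[OF vA(2)[OF xS] vA(1)] nq[OF xS] by blast
    qed
    then have "x \<notin> W" using x unfolding S_def by blast
    moreover have "c x = b" using \<alpha>P[OF S(4)] w0(2) P by auto
    moreover have "(x, w) \<notin> edges B" if "w \<in> W" for w
      using \<alpha>E[of w] EV[of x w] that U(4) unfolding S_def by blast
    ultimately show ?thesis using x \<alpha>E S(3) by blast
  qed
  show ?thesis
  proof (rule that[of c], unfold_locales)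
    show "countable (verts B)" by (rule cV)
    show "u \<in> verts B \<and> v \<in> verts B" if "(u, v) \<in> edges B" for u v using EV that .
    show "(v, u) \<in> edges B" "c u \<noteq> c v" if "(u, v) \<in> edges B" for u v using E that by blast+
    show "(u, v) \<in> parts B \<longleftrightarrow> u \<in> verts B \<and> v \<in> verts B \<and> c u = c v" for u v by (rule P)
  qed (rule ext)
qed

section \<open>Endomorphisms of the universal bipartite graph\<close>

context generic_bipartite
begin

abbreviation "M \<equiv> End_monoid B"

lemma is_bstruct: "is_bstruct B"
  unfolding is_bstruct_def by (auto dest: edges_verts simp: parts_iff)

sublocale monoid M
  by (rule monoid_End_monoid[OF is_bstruct])

lemma mult_End: "f \<otimes>\<^bsub>M\<^esub> g = compose (verts B) g f"
  by (simp add: End_monoid_def)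

lemma endomorphismD:
  assumes "f \<in> carrier M"
  shows "x \<in> verts B \<Longrightarrow> f x \<in> verts B"
    and "(x, y) \<in> edges B \<Longrightarrow> (f x, f y) \<in> edges B"
    and "x \<in> verts B \<Longrightarrow> y \<in> verts B \<Longrightarrow> c x = c y \<Longrightarrow> c (f x) = c (f y)"
    and "f \<in> extensional (verts B)"
proof -
  have f: "f \<in> extensional (verts B)" "f ` verts B \<subseteq> verts B"
    "\<And>x y. (x, y) \<in> edges B \<Longrightarrow> (f x, f y) \<in> edges B"
    "\<And>x y. (x, y) \<in> parts B \<Longrightarrow> (f x, f y) \<in> parts B"
    using assms unfolding End_monoid_def bhom_def by simp_all
  show "x \<in> verts B \<Longrightarrow> f x \<in> verts B" "(x, y) \<in> edges B \<Longrightarrow> (f x, f y) \<in> edges B"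
    "f \<in> extensional (verts B)" using f(1-3) by blast+
  show "x \<in> verts B \<Longrightarrow> y \<in> verts B \<Longrightarrow> c x = c y \<Longrightarrow> c (f x) = c (f y)"
    using f(4)[of x y] parts_iff by blast
qed

lemma endomorphismI:
  assumes "\<And>x. x \<in> verts B \<Longrightarrow> f x \<in> verts B"
    and "\<And>x y. (x, y) \<in> edges B \<Longrightarrow> (f x, f y) \<in> edges B"
    and "\<And>x y. x \<in> verts B \<Longrightarrow> y \<in> verts B \<Longrightarrow> c x = c y \<Longrightarrow> c (f x) = c (f y)"
  shows "restrict f (verts B) \<in> carrier M"
proof -
  have "(restrict f (verts B) x, restrict f (verts B) y) \<in> edges B" if "(x, y) \<in> edges B" for x y
    using assms(2)[OF that] edges_verts[OF that] by simp
  moreover have "(restrict f (verts B) x, restrict f (verts B) y) \<in> parts B" if "(x, y) \<in> parts B" for x y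
    using assms(1)[of x] assms(1)[of y] assms(3)[of x y] that unfolding parts_iff by simp
  ultimately show ?thesis using assms(1) unfolding End_monoid_def bhom_def by auto
qed

lemma endomorphism_eqI:
  assumes "f \<in> carrier M" "g \<in> carrier M" "\<And>x. x \<in> verts B \<Longrightarrow> f x = g x"
  shows "f = g"
  by (rule extensionalityI[OF endomorphismD(4)[OF assms(1)] endomorphismD(4)[OF assms(2)] assms(3)])

section \<open>Copies of countable graphs in \<open>B\<close> and extension of homomorphisms\<close>

lemma ex_edge: obtains x y where "(x, y) \<in> edges B" "c x" "\<not> c y"
proof -
  obtain x where x: "x \<in> verts B" "c x" using extension[of "{}" "{}" True] by auto
  obtain y where "y \<in> verts B" "\<not> c y" "(y, x) \<in> edges B"
    using extension[of "{x}" "{}" False] x by auto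
  with x that edges_sym show ?thesis by blast
qed

text \<open>The copy avoids, at stage \<open>n\<close>, all adjacencies with the first \<open>n\<close> vertices not yet used; this
  is what makes the neighbourhoods in the last clause finite.\<close>

lemma generic_copy:
  fixes lab :: "nat \<Rightarrow> 'l" and R :: "'l \<Rightarrow> 'l \<Rightarrow> bool" and d :: "'l \<Rightarrow> bool"
  assumes R_sym: "\<And>a b. R a b \<Longrightarrow> R b a" and R_d: "\<And>a b. R a b \<Longrightarrow> d a \<noteq> d b"
  obtains \<theta> :: "nat \<Rightarrow> 'v" where "inj \<theta>" "range \<theta> \<subseteq> verts B" "\<And>n. c (\<theta> n) = d (lab n)"
    "\<And>m n. (\<theta> m, \<theta> n) \<in> edges B \<longleftrightarrow> R (lab m) (lab n)"
    "\<And>x. x \<in> verts B - range \<theta> \<Longrightarrow> finite {n. (x, \<theta> n) \<in> edges B}"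
proof -
  obtain v :: "nat \<Rightarrow> 'v" where v: "range v = verts B"
    using ex_edge edges_verts countable_verts
    by (metis empty_iff range_from_nat_into)
  define Q where "Q \<theta> n x \<longleftrightarrow> x \<in> verts B \<and> c x = d (lab n) \<and>
     (\<forall>i<n. x \<noteq> \<theta> i \<and> ((x, \<theta> i) \<in> edges B \<longleftrightarrow> R (lab n) (lab i))) \<and>
     (\<forall>j<n. v j \<notin> \<theta> ` {..<n} \<longrightarrow> (x, v j) \<notin> edges B)" for \<theta> n x
  have "\<exists>\<theta>. \<forall>n. Q \<theta> n (\<theta> n)"
  proof (rule dependent_wellorder_choice)
    fix r n and \<theta> \<theta>' :: "nat \<Rightarrow> 'v" assume eq: "\<And>m::nat. m < n \<Longrightarrow> \<theta> m = \<theta>' m"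
    then have "\<theta> ` {..<n} = \<theta>' ` {..<n}" by auto
    with eq show "Q \<theta> n r = Q \<theta>' n r" unfolding Q_def by auto
  next
    fix n \<theta> assume IH: "\<And>m. m < n \<Longrightarrow> Q \<theta> m (\<theta> m)"
    \<comment> \<open>\<open>U\<close> and the first half of \<open>W\<close> prescribe the
      adjacencies to the vertices already chosen; the second half of \<open>W\<close> keeps the new
      vertex away from the listed vertices that have not been chosen.\<close>
    define U where "U = \<theta> ` {i. i < n \<and> R (lab n) (lab i)}"
    define W where "W = \<theta> ` {i. i < n \<and> \<not> R (lab n) (lab i)} \<union> (v ` {..<n} - \<theta> ` {..<n})"
    have inj: "i = j" if "i < n" "j < n" "\<theta> i = \<theta> j" for i j
      using that IH[of i] IH[of j] unfolding Q_def by (metis linorder_neqE_nat)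
    have fin: "finite U" "finite W" unfolding U_def W_def by auto
    have UV: "U \<subseteq> verts B" using IH unfolding U_def Q_def by auto
    have disj: "U \<inter> W = {}" unfolding U_def W_def using inj by blast
    have col: "c u \<noteq> d (lab n)" if "u \<in> U" for u
      using that IH R_d unfolding U_def Q_def by auto
    obtain x where x: "x \<in> verts B" "x \<notin> W" "c x = d (lab n)"
      "\<forall>u\<in>U. (x, u) \<in> edges B" "\<forall>w\<in>W. (x, w) \<notin> edges B"
      using extension[OF fin UV disj col] by blast
    have "x \<noteq> \<theta> i \<and> ((x, \<theta> i) \<in> edges B \<longleftrightarrow> R (lab n) (lab i))" if "i < n" for i
    proof (cases "R (lab n) (lab i)")
      case True
      then have "\<theta> i \<in> U" using that unfolding U_def by blast
      then show ?thesis using True x(3,4) col by blast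
    next
      case False
      then have "\<theta> i \<in> W" using that unfolding W_def by blast
      then show ?thesis using False x(2,5) by blast
    qed
    moreover have "(x, v j) \<notin> edges B" if "j < n" "v j \<notin> \<theta> ` {..<n}" for j
      using that x(5) unfolding W_def by blast
    ultimately show "\<exists>x. Q \<theta> n x" unfolding Q_def using x by blast
  qed
  then obtain \<theta> where \<theta>: "\<And>n. Q \<theta> n (\<theta> n)" by blast
  show thesis
  proof (rule that[of \<theta>])
    show "inj \<theta>" by (rule injI) (metis \<theta> Q_def linorder_neqE_nat)
    show "range \<theta> \<subseteq> verts B" "c (\<theta> n) = d (lab n)" for n using \<theta> unfolding Q_def by auto
    have lt: "(\<theta> m, \<theta> n) \<in> edges B \<longleftrightarrow> R (lab m) (lab n)" if "n < m" for m n
      using \<theta>[of m] that unfolding Q_def by blast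
    show "(\<theta> m, \<theta> n) \<in> edges B \<longleftrightarrow> R (lab m) (lab n)" for m n
    proof (cases m n rule: linorder_cases)
      case less then show ?thesis using lt[of m n] edges_sym R_sym by blast
    next
      case equal then show ?thesis using edges_colour R_d by blast
    qed (rule lt)
    show "finite {n. (x, \<theta> n) \<in> edges B}" if "x \<in> verts B - range \<theta>" for x
    proof -
      \<comment> \<open>If \<open>x\<close> is \<open>v j\<close> and never chosen, then every stage
        after \<open>j\<close> avoids adjacency with it, so its neighbours in the copy have index at
        most \<open>j\<close>.\<close>
      have "x \<in> range v" using that v by simp
      then obtain j where j: "x = v j" by blast
      have "(x, \<theta> n) \<notin> edges B" if "j < n" for n
      proof -
        have "v j \<notin> \<theta> ` {..<n}" using \<open>x \<in> verts B - range \<theta>\<close> j by blast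
        then have "(\<theta> n, v j) \<notin> edges B" using \<theta>[of n] that unfolding Q_def by blast
        then show ?thesis using edges_sym j by blast
      qed
      then have "{n. (x, \<theta> n) \<in> edges B} \<subseteq> {..j}" by (auto simp: not_less[symmetric])
      then show ?thesis by (rule finite_subset) simp
    qed
  qed
qed

text \<open>The vertices outside \<open>T\<close> receive their values along an enumeration. At each
  of them only finitely many values impose a condition: those of its neighbours in \<open>T\<close>
  and of its earlier neighbours. All of these lie in \<Gamma> and have the opposite colour, so they
  have a common neighbour in \<Gamma> of the right colour.\<close>

lemma colour_hom_extension:
  assumes \<Gamma>: "\<And>A b. \<lbrakk>finite A; A \<subseteq> \<Gamma>; \<And>a. a \<in> A \<Longrightarrow> c a \<noteq> b\<rbrakk> \<Longrightarrow>
      \<exists>y\<in>\<Gamma>. c y = b \<and> (\<forall>a\<in>A. (y, a) \<in> edges B)"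
    and T: "T \<subseteq> verts B" "\<And>x. x \<in> verts B - T \<Longrightarrow> finite {u \<in> T. (x, u) \<in> edges B}"
    and p: "\<And>x. x \<in> T \<Longrightarrow> p x \<in> \<Gamma> \<and> c (p x) = c x"
      "\<And>x y. \<lbrakk>x \<in> T; y \<in> T; (x, y) \<in> edges B\<rbrakk> \<Longrightarrow> (p x, p y) \<in> edges B"
  obtains \<psi> where "\<And>x. x \<in> T \<Longrightarrow> \<psi> x = p x" "\<And>x. x \<in> verts B \<Longrightarrow> \<psi> x \<in> \<Gamma> \<and> c (\<psi> x) = c x"
    "\<And>x y. (x, y) \<in> edges B \<Longrightarrow> (\<psi> x, \<psi> y) \<in> edges B"
proof -
  define idx where "idx = to_nat_on (verts B)"
  have idx: "inj_on idx (verts B)" unfolding idx_def using countable_verts by (rule inj_on_to_nat_on)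
  define Q where "Q \<psi> x y \<longleftrightarrow> (x \<in> T \<longrightarrow> y = p x) \<and> (x \<in> verts B - T \<longrightarrow> y \<in> \<Gamma> \<and> c y = c x \<and>
     (\<forall>u\<in>T. (x, u) \<in> edges B \<longrightarrow> (y, p u) \<in> edges B) \<and>
     (\<forall>u\<in>verts B - T. idx u < idx x \<longrightarrow> (x, u) \<in> edges B \<longrightarrow> (y, \<psi> u) \<in> edges B))" for \<psi> x y
  have "\<exists>\<psi>. \<forall>x. Q \<psi> x (\<psi> x)"
  proof (rule dependent_wf_choice[of "measure idx"])
    show "wf (measure idx)" by simp
  next
    fix r x and \<psi> \<psi>' :: "'v \<Rightarrow> 'v" assume "\<And>z. (z, x) \<in> measure idx \<Longrightarrow> \<psi> z = \<psi>' z"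
    then show "Q \<psi> x r = Q \<psi>' x r" unfolding Q_def by auto
  next
    fix x \<psi> assume IH: "\<And>y. (y, x) \<in> measure idx \<Longrightarrow> Q \<psi> y (\<psi> y)"
    show "\<exists>y. Q \<psi> x y"
    proof (cases "x \<in> verts B - T")
      case True
      define N where "N = {u \<in> verts B - T. idx u < idx x \<and> (x, u) \<in> edges B}"
      define A where "A = p ` {u \<in> T. (x, u) \<in> edges B} \<union> \<psi> ` N"
      have "finite (idx ` N)" by (rule finite_subset[of _ "{..<idx x}"]) (auto simp: N_def)
      moreover have "inj_on idx N" by (rule inj_on_subset[OF idx]) (auto simp: N_def)
      ultimately have "finite N" by (rule finite_imageD)
      then have "finite A" using T(2)[OF True] unfolding A_def by simp
      moreover have "\<psi> u \<in> \<Gamma> \<and> c (\<psi> u) = c u" if "u \<in> N" for u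
        using IH[of u] that unfolding Q_def N_def by auto
      then have "A \<subseteq> \<Gamma>" "\<And>a. a \<in> A \<Longrightarrow> c a \<noteq> c x"
        using p(1) edges_colour unfolding A_def N_def by fastforce+
      ultimately obtain y where "y \<in> \<Gamma>" "c y = c x" "\<forall>a\<in>A. (y, a) \<in> edges B"
        using \<Gamma>[of A "c x"] by blast
      then have "Q \<psi> x y" using True unfolding Q_def A_def N_def by blast
      then show ?thesis ..
    next
      case False
      then show ?thesis unfolding Q_def by blast
    qed
  qed
  then obtain \<psi> where \<psi>: "\<And>x. Q \<psi> x (\<psi> x)" by blast
  have one: "(\<psi> x, \<psi> y) \<in> edges B"
    if "(x, y) \<in> edges B" "x \<in> verts B - T" "y \<in> T \<or> idx y < idx x" for x y
    using \<psi>[of x] \<psi>[of y] that edges_verts[OF that(1)] unfolding Q_def by (cases "y \<in> T") auto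
  show thesis
  proof (rule that[of \<psi>])
    show "\<psi> x = p x" if "x \<in> T" for x using \<psi>[of x] that unfolding Q_def by blast
    show "\<psi> x \<in> \<Gamma> \<and> c (\<psi> x) = c x" if "x \<in> verts B" for x
      using \<psi>[of x] that p(1) unfolding Q_def by (cases "x \<in> T") auto
    show "(\<psi> x, \<psi> y) \<in> edges B" if xy: "(x, y) \<in> edges B" for x y
    proof -
      have V: "x \<in> verts B" "y \<in> verts B" using edges_verts[OF xy] by auto
      \<comment> \<open>Each edge not inside \<open>T\<close> has an end outside \<open>T\<close>
        whose other end is in \<open>T\<close> or comes earlier. The condition \<open>Q\<close> at
        that end covers the edge, up to symmetry.\<close>
      have "idx x \<noteq> idx y" using idx V xy edges_colour unfolding inj_on_def by blast
      then consider "x \<in> T" "y \<in> T" | "x \<notin> T" "y \<in> T \<or> idx y < idx x" | "y \<notin> T" "x \<in> T \<or> idx x < idx y"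
        by linarith
      then show ?thesis
      proof cases
        case 1
        then show ?thesis using \<psi>[of x] \<psi>[of y] p(2)[of x y] xy unfolding Q_def by auto
      next
        case 2
        then show ?thesis using one[OF xy] V by blast
      next
        case 3
        then show ?thesis using one[OF edges_sym[OF xy]] V edges_sym by blast
      qed
    qed
  qed
qed

section \<open>Regular endomorphisms and families inside their D-class\<close>

lemma regular_section:
  assumes "regular_element M f"
  obtains g where "f \<in> carrier M" "g \<in> carrier M" "\<And>y. y \<in> f ` verts B \<Longrightarrow> f (g y) = y"
proof -
  obtain g where g: "f \<in> carrier M" "g \<in> carrier M" and fgf: "f \<otimes>\<^bsub>M\<^esub> g \<otimes>\<^bsub>M\<^esub> f = f"
    using assms unfolding regular_element_def by blast
  have "f (g (f x)) = f x" if "x \<in> verts B" for x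
    using fun_cong[OF fgf, of x] that by (simp add: mult_End compose_def)
  then show thesis using that[OF g] by blast
qed

text \<open>The map sending \<open>x\<close> to \<open>f (g x)\<close> is an endomorphism into the
  image of \<open>f\<close> that fixes this image pointwise. It carries a common neighbour of
  \<open>A\<close> in \<open>B\<close> to a common neighbour inside the image.\<close>

lemma regular_image_algebraically_closed:
  assumes f: "regular_element M f" and A: "finite A" "A \<subseteq> f ` verts B" "\<And>a. a \<in> A \<Longrightarrow> c a \<noteq> b"
  shows "\<exists>y\<in>f ` verts B. c y = b \<and> (\<forall>a\<in>A. (y, a) \<in> edges B)"
proof -
  obtain g where fM: "f \<in> carrier M" and gM: "g \<in> carrier M"
    and e: "\<And>y. y \<in> f ` verts B \<Longrightarrow> f (g y) = y"
    by (rule regular_section[OF f]) blast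
  note F = endomorphismD[OF fM] and G = endomorphismD[OF gM]
  obtain x0 y0 where xy: "(x0, y0) \<in> edges B" by (rule ex_edge)
  then have fxy: "(f x0, f y0) \<in> edges B" by (rule F)
  \<comment> \<open>An image vertex of colour \<open>b\<close>, taken from the image of an edge.
    Being fixed by the retraction, it shows that vertices of colour \<open>b\<close> keep their
    colour, even when \<open>A\<close> is empty.\<close>
  define z where "z = (if c (f x0) = b then f x0 else f y0)"
  have z: "z \<in> f ` verts B" "c z = b" "z \<in> verts B"
    using edges_verts[OF xy] edges_colour[OF fxy] edges_verts[OF fxy] unfolding z_def by auto
  have AV: "A \<subseteq> verts B" using A F(1) by blast
  obtain x where x: "x \<in> verts B" "c x = b" "\<forall>a\<in>A. (x, a) \<in> edges B"
    using extension[OF A(1) finite.emptyI AV _ A(3)] by auto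
  have "c (f (g x)) = c (f (g z))" using x z by (intro F(3) G(3) G(1)) auto
  then have "c (f (g x)) = b" using e z by simp
  moreover have "(f (g x), a) \<in> edges B" if "a \<in> A" for a
    using F(2)[OF G(2), of x a] x that e[of a] A by auto
  moreover have "f (g x) \<in> f ` verts B" using G(1)[OF x(1)] by blast
  ultimately show ?thesis by blast
qed

text \<open>\<open>k s\<close> sends \<open>x\<close> to copy number \<open>s (f x)\<close> of
  \<open>f x\<close>, while \<open>h X\<close> collapses all copies back to the image of
  \<open>f\<close> and sends the isolated vertex number \<open>n\<close> of the embedded graph to
  \<open>a\<close> or \<open>a'\<close> according to whether \<open>n\<close> lies in
  \<open>X\<close>. The image of \<open>k s\<close> remembers \<open>s\<close>, and the kernel of
  \<open>h X\<close> remembers \<open>X\<close>. Equality of \<open>a\<close> and \<open>a'\<close>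
  is allowed so that \<open>k\<close> can be obtained from a single image vertex.\<close>

lemma regular_D_class_families:
  assumes f: "regular_element M f" and a: "a \<in> f ` verts B" "a' \<in> f ` verts B" "c a = c a'"
  obtains k :: "('v \<Rightarrow> nat) \<Rightarrow> 'v \<Rightarrow> 'v" and h :: "nat set \<Rightarrow> 'v \<Rightarrow> 'v" where
    "\<And>s. (f, k s) \<in> green_R M"
    "\<And>s t y. (k s, k t) \<in> green_L M \<Longrightarrow> y \<in> f ` verts B \<Longrightarrow> s y = t y"
    "\<And>X. (f, h X) \<in> green_L M"
    "\<And>X Y. (h X, h Y) \<in> green_R M \<Longrightarrow> a \<noteq> a' \<Longrightarrow> X = Y"
proof -
  define \<Gamma> where "\<Gamma> = f ` verts B"
  obtain g where fM: "f \<in> carrier M" and gM: "g \<in> carrier M" and e: "\<And>y. y \<in> \<Gamma> \<Longrightarrow> f (g y) = y"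
    unfolding \<Gamma>_def by (rule regular_section[OF f]) blast
  note F = endomorphismD[OF fM] and G = endomorphismD[OF gM]
  have f\<Gamma>: "f x \<in> \<Gamma>" if "x \<in> verts B" for x using that unfolding \<Gamma>_def by blast
  have \<Gamma>V: "y \<in> verts B" if "y \<in> \<Gamma>" for y using that F(1) unfolding \<Gamma>_def by blast
  have closed: "\<exists>y\<in>\<Gamma>. c y = b \<and> (\<forall>x\<in>A. (y, x) \<in> edges B)"
    if "finite A" "A \<subseteq> \<Gamma>" "\<And>x. x \<in> A \<Longrightarrow> c x \<noteq> b" for A b
    using regular_image_algebraically_closed[OF f] that unfolding \<Gamma>_def by blast
  \<comment> \<open>The label \<open>None\<close> marks the isolated vertices; each label occurs infinitely often in \<open>lab\<close>.\<close>
  define D where "D = insert None (Some ` \<Gamma>)"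
  define num where "num = to_nat_on D"
  \<comment> \<open>\<open>pos l m\<close> is the position of copy number \<open>m\<close> of the
    label \<open>l\<close>.\<close>
  define pos where "pos l m = prod_encode (num l, m)" for l and m :: nat
  define lab where "lab n = from_nat_into D (fst (prod_decode n))" for n
  have "countable \<Gamma>" unfolding \<Gamma>_def using countable_verts by simp
  then have cD: "countable D" unfolding D_def by simp
  then have num: "inj_on num D" unfolding num_def by (rule inj_on_to_nat_on)
  have lab_pos: "lab (pos l m) = l" if "l \<in> D" for l m
    using cD that by (simp add: lab_def pos_def num_def)
  have pos_eq: "l = l' \<and> m = m'" if "pos l m = pos l' m'" "l \<in> D" "l' \<in> D" for l l' m m'
    using that num unfolding pos_def inj_on_def by simp
  have lab_D: "lab n \<in> D" for n
    unfolding lab_def by (rule from_nat_into) (simp add: D_def)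
  define R where "R l l' \<longleftrightarrow> (\<exists>y y'. l = Some y \<and> l' = Some y' \<and> (y, y') \<in> edges B)" for l l'
  \<comment> \<open>The isolated vertices get the common colour of \<open>a\<close> and
    \<open>a'\<close>, so both are admissible values for them.\<close>
  define d where "d l = (case l of None \<Rightarrow> c a | Some y \<Rightarrow> c y)" for l
  have R_sym: "R l' l" if "R l l'" for l l' using that edges_sym unfolding R_def by blast
  have R_d: "d l \<noteq> d l'" if "R l l'" for l l'
    using that edges_colour unfolding R_def d_def by fastforce
  obtain \<theta> where \<theta>: "inj \<theta>" "range \<theta> \<subseteq> verts B" "\<And>n. c (\<theta> n) = d (lab n)"
    "\<And>m n. (\<theta> m, \<theta> n) \<in> edges B \<longleftrightarrow> R (lab m) (lab n)"
    "\<And>x. x \<in> verts B - range \<theta> \<Longrightarrow> finite {n. (x, \<theta> n) \<in> edges B}"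
    using generic_copy[of R d lab, OF R_sym R_d] by blast
  define val where "val X n = (case lab n of Some y \<Rightarrow> y
      | None \<Rightarrow> if snd (prod_decode n) \<in> X then a else a')" for X n
  have a\<Gamma>: "a \<in> \<Gamma>" "a' \<in> \<Gamma>" using a unfolding \<Gamma>_def by auto
  have val: "val X n \<in> \<Gamma> \<and> c (val X n) = d (lab n)" for X n
    using lab_D[of n] a\<Gamma> a(3) unfolding val_def d_def D_def by auto
  have val_edge: "(val X m, val X n) \<in> edges B" if "R (lab m) (lab n)" for X m n
    using that unfolding val_def R_def by auto
  \<comment> \<open>The prescribed values \<open>val X\<close> are transported along \<theta> to the
    embedded copy and then extended to all of \<open>B\<close> within the image of
    \<open>f\<close>.\<close>
  have "\<exists>\<psi>. (\<forall>n. \<psi> (\<theta> n) = val X n) \<and> (\<forall>x\<in>verts B. \<psi> x \<in> \<Gamma> \<and> c (\<psi> x) = c x) \<and>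
      (\<forall>x y. (x, y) \<in> edges B \<longrightarrow> (\<psi> x, \<psi> y) \<in> edges B)" for X
  proof -
    define p where "p x = val X (inv_into UNIV \<theta> x)" for x
    have p: "p (\<theta> n) = val X n" for n using \<theta>(1) by (simp add: p_def)
    have fin: "finite {u \<in> range \<theta>. (x, u) \<in> edges B}" if "x \<in> verts B - range \<theta>" for x
    proof -
      have "{u \<in> range \<theta>. (x, u) \<in> edges B} = \<theta> ` {n. (x, \<theta> n) \<in> edges B}" by blast
      then show ?thesis using \<theta>(5)[OF that] by simp
    qed
    obtain \<psi> where "\<And>x. x \<in> range \<theta> \<Longrightarrow> \<psi> x = p x" "\<And>x. x \<in> verts B \<Longrightarrow> \<psi> x \<in> \<Gamma> \<and> c (\<psi> x) = c x"
      "\<And>x y. (x, y) \<in> edges B \<Longrightarrow> (\<psi> x, \<psi> y) \<in> edges B"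
    proof (rule colour_hom_extension[of \<Gamma> "range \<theta>" p])
      show "p x \<in> \<Gamma> \<and> c (p x) = c x" if "x \<in> range \<theta>" for x
        using that val \<theta>(3) p by auto
      show "(p x, p y) \<in> edges B" if "x \<in> range \<theta>" "y \<in> range \<theta>" "(x, y) \<in> edges B" for x y
        using that val_edge \<theta>(4) p by auto
    qed (use closed \<theta>(2) fin in blast)+
    then show ?thesis using p by (metis rangeI)
  qed
  then obtain \<psi> where \<psi>: "\<And>X n. \<psi> X (\<theta> n) = val X n"
    "\<And>X x. x \<in> verts B \<Longrightarrow> \<psi> X x \<in> \<Gamma> \<and> c (\<psi> X x) = c x"
    "\<And>X x y. (x, y) \<in> edges B \<Longrightarrow> (\<psi> X x, \<psi> X y) \<in> edges B"
    by metis
  define \<phi> where "\<phi> s y = \<theta> (pos (Some y) (s y))" for s y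
  have SD: "Some y \<in> D" if "y \<in> \<Gamma>" for y using that unfolding D_def by blast
  have \<phi>V: "\<phi> s y \<in> verts B" for s y using \<theta>(2) unfolding \<phi>_def by blast
  have \<phi>c: "c (\<phi> s y) = c y" if "y \<in> \<Gamma>" for s y
    using lab_pos[OF SD[OF that]] \<theta>(3) by (simp add: \<phi>_def d_def)
  have \<phi>E: "(\<phi> s y, \<phi> s y') \<in> edges B" if "y \<in> \<Gamma>" "y' \<in> \<Gamma>" "(y, y') \<in> edges B" for s y y'
    using lab_pos[OF SD[OF that(1)]] lab_pos[OF SD[OF that(2)]] \<theta>(4) that by (simp add: \<phi>_def R_def)
  have \<psi>\<phi>: "\<psi> X (\<phi> s y) = y" if "y \<in> \<Gamma>" for X s y
    using lab_pos[OF SD[OF that]] \<psi>(1) by (simp add: \<phi>_def val_def)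
  define h where "h X = restrict (\<psi> X) (verts B)" for X
  define k where "k s = restrict (\<lambda>x. \<phi> s (f x)) (verts B)" for s
  \<comment> \<open>\<phi> \<open>s\<close> respects edges and colours only on \<Gamma>, so it is
    preceded by the retraction \<open>x\<close> to \<open>f (g x)\<close>, which changes nothing on
    \<Gamma>. This makes \<open>r s\<close> an endomorphism with \<open>k s\<close> equal to
    \<open>f\<close> followed by \<open>r s\<close>.\<close>
  define r where "r s = restrict (\<lambda>x. \<phi> s (f (g x))) (verts B)" for s
  have hM: "h X \<in> carrier M" for X
    unfolding h_def by (rule endomorphismI) (use \<psi> \<Gamma>V in \<open>simp_all\<close>)
  have \<phi>M: "restrict (\<lambda>x. \<phi> s (q x)) (verts B) \<in> carrier M"
    if "q \<in> carrier M" "\<And>x. x \<in> verts B \<Longrightarrow> q x \<in> \<Gamma>" for q s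
  proof (rule endomorphismI)
    show "(\<phi> s (q x), \<phi> s (q y)) \<in> edges B" if xy: "(x, y) \<in> edges B" for x y
      using \<phi>E endomorphismD(2)[OF \<open>q \<in> carrier M\<close> xy] edges_verts[OF xy] \<open>\<And>x. x \<in> verts B \<Longrightarrow> q x \<in> \<Gamma>\<close>
      by blast
    show "c (\<phi> s (q x)) = c (\<phi> s (q y))" if "x \<in> verts B" "y \<in> verts B" "c x = c y" for x y
      using endomorphismD(3)[OF \<open>q \<in> carrier M\<close> that] \<phi>c \<open>\<And>x. x \<in> verts B \<Longrightarrow> q x \<in> \<Gamma>\<close> that by simp
  qed (rule \<phi>V)
  have kM: "k s \<in> carrier M" for s unfolding k_def using fM f\<Gamma> by (rule \<phi>M)
  have "restrict (\<lambda>x. \<phi> s ((g \<otimes>\<^bsub>M\<^esub> f) x)) (verts B) \<in> carrier M" for s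
  proof (rule \<phi>M)
    show "g \<otimes>\<^bsub>M\<^esub> f \<in> carrier M" using gM fM by (rule m_closed)
    show "(g \<otimes>\<^bsub>M\<^esub> f) x \<in> \<Gamma>" if "x \<in> verts B" for x
      using f\<Gamma>[OF G(1)[OF that]] that by (simp add: mult_End compose_def)
  qed
  moreover have "restrict (\<lambda>x. \<phi> s ((g \<otimes>\<^bsub>M\<^esub> f) x)) (verts B) = r s" for s
    by (rule ext) (simp add: mult_End compose_def r_def)
  ultimately have rM: "r s \<in> carrier M" for s by simp
  \<comment> \<open>Three factorizations: \<open>e1\<close> and \<open>e2\<close> place
    \<open>k s\<close> in the R-class of \<open>f\<close>; \<open>e2\<close> and \<open>e3\<close>
    place \<open>h X\<close> in its L-class. \<open>e2\<close> holds because \<psi> undoes the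
    choice of copies, \<open>e3\<close> because \<open>h X\<close> takes values where
    \<open>g\<close> is a section of \<open>f\<close>.\<close>
  have e1: "k s = f \<otimes>\<^bsub>M\<^esub> r s" for s
    by (rule ext) (simp add: mult_End compose_def k_def r_def F(1) e f\<Gamma>)
  have e2: "f = k s \<otimes>\<^bsub>M\<^esub> h X" for s X
    by (rule endomorphism_eqI[OF fM m_closed[OF kM hM]])
      (simp add: mult_End compose_def k_def h_def \<phi>V \<psi>\<phi> f\<Gamma>)
  have e3: "h X = (h X \<otimes>\<^bsub>M\<^esub> g) \<otimes>\<^bsub>M\<^esub> f" for X
    by (rule ext) (simp add: mult_End compose_def h_def \<psi> e \<Gamma>V)
  show thesis
  proof (rule that[of k h])
    show "(f, k s) \<in> green_R M" for s
      using e1 e2 fM kM rM hM unfolding green_R_iff by blast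
    show "(f, h X) \<in> green_L M" for X
      using e3 e2 fM kM gM hM m_closed unfolding green_L_iff by blast
    show "s y = t y" if st: "(k s, k t) \<in> green_L M" and y: "y \<in> f ` verts B" for s t y
    proof -
      obtain x where x: "x \<in> verts B" "y = f x" using y by blast
      obtain m where m: "m \<in> carrier M" "k s = m \<otimes>\<^bsub>M\<^esub> k t" using st unfolding green_L_iff by blast
      have mx: "m x \<in> verts B" using endomorphismD(1)[OF m(1) x(1)] .
      have "k s x = k t (m x)" using m(2) x(1) by (simp add: mult_End compose_def)
      then have "\<phi> s y = \<phi> t (f (m x))" using x mx by (simp add: k_def)
      \<comment> \<open>A vertex of the copy determines both its label and its copy number, so equal
        image vertices force equal values of \<open>s\<close> and \<open>t\<close>.\<close>
      then have "pos (Some y) (s y) = pos (Some (f (m x))) (t (f (m x)))"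
        using \<theta>(1) unfolding \<phi>_def inj_def by blast
      then have "Some y = Some (f (m x)) \<and> s y = t (f (m x))"
        by (rule pos_eq) (use x mx f\<Gamma> SD in auto)
      then have "y = f (m x)" "s y = t (f (m x))" by blast+
      then show ?thesis by metis
    qed
    have sub: "X \<subseteq> Y" if XY: "(h X, h Y) \<in> green_R M" "a \<noteq> a'" for X Y
    proof
      fix n assume n: "n \<in> X"
      obtain m where m: "h Y = h X \<otimes>\<^bsub>M\<^esub> m" using XY(1) unfolding green_R_iff by blast
      \<comment> \<open>R-related maps have the same kernel. \<open>h Z\<close> identifies the
        isolated vertex \<open>u\<close> with the copy \<open>v\<close> of \<open>a\<close> exactly
        when \<open>n\<close> lies in \<open>Z\<close>, since \<open>a\<close> and \<open>a'\<close>
        differ.\<close>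
      define u where "u = \<theta> (pos None n)"
      define v where "v = \<phi> (\<lambda>_. 0) a"
      have uv: "u \<in> verts B" "v \<in> verts B" using \<theta>(2) \<phi>V unfolding u_def v_def by auto
      have ND: "None \<in> D" unfolding D_def by simp
      have hu: "h Z u = (if n \<in> Z then a else a')" for Z
        using uv(1) lab_pos[OF ND] by (simp add: h_def u_def \<psi>(1) val_def) (simp add: pos_def)
      have hv: "h Z v = a" for Z using uv(2) \<psi>\<phi>[OF a\<Gamma>(1)] by (simp add: h_def v_def)
      have "h X u = h X v" using hu hv n by simp
      then have "h Y u = h Y v" using uv unfolding m by (simp add: mult_End compose_def)
      then show "n \<in> Y" using hu[of Y] hv[of Y] XY(2) by (simp split: if_splits)
    qed
    show "X = Y" if "(h X, h Y) \<in> green_R M" "a \<noteq> a'" for X Y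
    proof -
      have "(h Y, h X) \<in> green_R M" using that(1) unfolding green_R_iff by simp
      then show ?thesis using sub that by (intro subset_antisym)
    qed
  qed
qed

section \<open>Upper bounds on the number of classes\<close>

text \<open>An endomorphism is determined by its graph on the countable vertex set, which pairing
  encodes as a set of natural numbers.\<close>

lemma endomorphisms_lepoll_continuum: "carrier M \<lesssim> (UNIV :: nat set set)"
proof -
  define idx where "idx = to_nat_on (verts B)"
  have idx: "inj_on idx (verts B)" unfolding idx_def using countable_verts by (rule inj_on_to_nat_on)
  have "inj_on (\<lambda>f. (\<lambda>x. prod_encode (idx x, idx (f x))) ` verts B) (carrier M)"
  proof (rule inj_onI)
    fix f g assume f: "f \<in> carrier M" and g: "g \<in> carrier M"
      and eq: "(\<lambda>x. prod_encode (idx x, idx (f x))) ` verts B = (\<lambda>x. prod_encode (idx x, idx (g x))) ` verts B"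
    show "f = g"
    proof (rule endomorphism_eqI[OF f g])
      fix x assume x: "x \<in> verts B"
      then have "prod_encode (idx x, idx (f x)) \<in> (\<lambda>x. prod_encode (idx x, idx (g x))) ` verts B"
        unfolding eq[symmetric] by blast
      then obtain y where y: "y \<in> verts B" "idx x = idx y" "idx (f x) = idx (g y)" by auto
      then have "x = y" using idx x unfolding inj_on_def by blast
      then show "f x = g x"
        using y(3) idx endomorphismD(1)[OF f x] endomorphismD(1)[OF g x] unfolding inj_on_def by blast
    qed
  qed
  then show ?thesis unfolding lepoll_def by blast
qed

text \<open>Every \<open>k\<close> in the R-class factors through \<open>f\<close> and is therefore
  constant on its fibres. So \<open>k\<close> is recovered from the set of pairs
  \<open>(f x, k x)\<close>, a finite subset of a countable set.\<close>

lemma countable_green_R_of_finite_image: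
  assumes "finite (f ` verts B)"
  shows "countable {k. (f, k) \<in> green_R M}"
proof -
  define gr where "gr k = (\<lambda>x. (f x, k x)) ` verts B" for k :: "'v \<Rightarrow> 'v"
  have inj: "inj_on gr {k. (f, k) \<in> green_R M}"
  proof (rule inj_onI)
    fix k l assume kl: "k \<in> {k. (f, k) \<in> green_R M}" "l \<in> {k. (f, k) \<in> green_R M}" and eq: "gr k = gr l"
    have k: "k \<in> carrier M" using kl(1) unfolding green_R_iff by simp
    obtain m where l: "l \<in> carrier M" "l = f \<otimes>\<^bsub>M\<^esub> m" using kl(2) unfolding green_R_iff by blast
    show "k = l"
    proof (rule endomorphism_eqI[OF k l(1)])
      fix x assume x: "x \<in> verts B"
      then have "(f x, k x) \<in> gr k" unfolding gr_def by (rule imageI)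
      then have "(f x, k x) \<in> gr l" unfolding eq .
      then obtain y where "y \<in> verts B" "f x = f y" "k x = l y" unfolding gr_def by blast
      then show "k x = l x" using l(2) x by (simp add: mult_End compose_def)
    qed
  qed
  have sub: "gr k \<in> {A. finite A \<and> A \<subseteq> verts B \<times> verts B}" if fk: "(f, k) \<in> green_R M" for k
  proof -
    obtain m where f: "f \<in> carrier M" and k: "k \<in> carrier M" "k = f \<otimes>\<^bsub>M\<^esub> m"
      using fk unfolding green_R_iff by blast
    have "gr k = (\<lambda>y. (y, m y)) ` (f ` verts B)"
      unfolding gr_def k(2) by (auto simp: mult_End compose_def image_iff)
    then have "finite (gr k)" using assms by simp
    then show ?thesis using endomorphismD(1)[OF f] endomorphismD(1)[OF k(1)] unfolding gr_def by blast
  qed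
  have "countable {A. finite A \<and> A \<subseteq> verts B \<times> verts B}"
    using countable_verts by (intro countable_Collect_finite_subset) simp
  then have "countable (gr ` {k. (f, k) \<in> green_R M})"
    by (rule countable_subset[rotated]) (use sub in blast)
  then show ?thesis using inj by (rule countable_image_inj_on)
qed

section \<open>Endomorphisms whose image is a single edge\<close>

text \<open>An edge of \<open>B\<close> is mapped to an edge, so both colours occur in the image.
  With at most one vertex of each colour, the image consists of just that edge.\<close>

lemma bimage_iso_K11I:
  assumes f: "f \<in> carrier M"
    and mono: "\<And>a a'. \<lbrakk>a \<in> f ` verts B; a' \<in> f ` verts B; c a = c a'\<rbrakk> \<Longrightarrow> a = a'"
  shows "bisomorphic (bimage B f) K11"
proof -
  note F = endomorphismD[OF f]
  obtain x y where xy: "(x, y) \<in> edges B" by (rule ex_edge)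
  then have V: "x \<in> verts B" "y \<in> verts B" using edges_verts by blast+
  have E: "(f x, f y) \<in> edges B" using F(2) xy .
  have col: "c (f x) \<noteq> c (f y)" using edges_colour[OF E] .
  have im: "f ` verts B = {f x, f y}"
  proof (intro subset_antisym subsetI)
    fix z assume z: "z \<in> f ` verts B"
    then show "z \<in> {f x, f y}"
      using mono[of z "f x"] mono[of z "f y"] V col by (cases "c z = c (f x)") auto
  qed (use V in auto)
  have "(f u, f v) \<in> {(f x, f y), (f y, f x)}" if "(u, v) \<in> edges B" for u v
  proof -
    have "f u \<in> {f x, f y}" "f v \<in> {f x, f y}" using edges_verts[OF that] im by blast+
    moreover have "f u \<noteq> f v" using edges_colour[OF F(2)[OF that]] by auto
    ultimately show ?thesis by auto
  qed
  then have ed: "edges (bimage B f) = {(f x, f y), (f y, f x)}"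
    using xy edges_sym[OF xy] unfolding bimage_def by auto
  have pa: "parts (bimage B f) = {(f x, f x), (f y, f y)}"
    using F(1)[OF V(1)] F(1)[OF V(2)] col unfolding bimage_def im by (auto simp: parts_iff)
  have "biso (\<lambda>z. if z = f x then 0 else 1) (bimage B f) K11"
    unfolding biso_def bembedding_def ed pa using col
    by (auto simp: bimage_def im K11_def inj_on_def)
  then show ?thesis unfolding bisomorphic_def by blast
qed

lemma bimage_iso_K11D:
  assumes f: "f \<in> carrier M" and iso: "bisomorphic (bimage B f) K11"
  obtains p q where "f ` verts B = {p, q}" "c p \<noteq> c q"
proof -
  obtain i where "biso i (bimage B f) K11" using iso unfolding bisomorphic_def by blast
  then have inj: "inj_on i (f ` verts B)" and im: "i ` f ` verts B = {0, 1}"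
    unfolding biso_def bembedding_def by (simp_all add: K11_def bimage_def)
  have "card (f ` verts B) = card {0, 1 :: nat}"
    using card_image[OF inj] unfolding im by simp
  then have "card (f ` verts B) = 2" by simp
  then obtain p q where pq: "f ` verts B = {p, q}" by (meson card_2_iff)
  obtain x y where xy: "(x, y) \<in> edges B" by (rule ex_edge)
  then have "c (f x) \<noteq> c (f y)" using endomorphismD(2)[OF f] edges_colour by blast
  moreover have "f x \<in> {p, q}" "f y \<in> {p, q}" using edges_verts[OF xy] pq by blast+
  ultimately show thesis using that[OF pq] by auto
qed

text \<open>Endomorphisms into two vertices of different colours are constant on each colour class.
  Hence \<open>k\<close> can be recovered from the colours of the values of
  \<open>f\<close>.\<close>

lemma two_vertex_image_right_multiple:
  assumes f: "f \<in> carrier M" and k: "k \<in> carrier M"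
    and im: "f ` verts B \<subseteq> {p, q}" "k ` verts B \<subseteq> {p, q}" and pq: "c p \<noteq> c q"
  shows "\<exists>u\<in>carrier M. k = f \<otimes>\<^bsub>M\<^esub> u"
proof -
  obtain x y where xy: "(x, y) \<in> edges B" by (rule ex_edge)
  then have V: "x \<in> verts B" "y \<in> verts B" using edges_verts by blast+
  have kE: "(k x, k y) \<in> edges B" using endomorphismD(2)[OF k xy] .
  have kV: "k x \<in> verts B" "k y \<in> verts B" using edges_verts[OF kE] by auto
  have colf: "c (f x) \<noteq> c (f y)" using edges_colour[OF endomorphismD(2)[OF f xy]] .
  have eq: "k z = k w" if "z \<in> verts B" "w \<in> verts B" "c z = c w" for z w
  proof -
    have "k z \<in> {p, q}" "k w \<in> {p, q}" using im(2) that by blast+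
    then show ?thesis using endomorphismD(3)[OF k that] pq by auto
  qed
  \<comment> \<open>\<open>u\<close> collapses \<open>B\<close> onto the edge from
    \<open>k x\<close> to \<open>k y\<close>. Comparing with the colour of \<open>f x\<close> takes
    care of the case in which \<open>f\<close> interchanges the parts.\<close>
  define u where "u z = (if c z = c (f x) then k x else k y)" for z
  have uM: "restrict u (verts B) \<in> carrier M"
  proof (rule endomorphismI)
    fix z w assume "(z, w) \<in> edges B"
    then show "(u z, u w) \<in> edges B"
      using edges_colour[of z w] kE edges_sym[OF kE] unfolding u_def by auto
  qed (auto simp: u_def kV)
  have "k = f \<otimes>\<^bsub>M\<^esub> restrict u (verts B)"
  proof (rule endomorphism_eqI[OF k m_closed[OF f uM]])
    fix z assume z: "z \<in> verts B"
    have "k z = u (f z)"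
    proof (cases "c z = c x")
      case True
      then show ?thesis using eq[OF z V(1)] endomorphismD(3)[OF f z V(1)] by (simp add: u_def)
    next
      case False
      then have "c z = c y" using edges_colour[OF xy] by blast
      then show ?thesis using eq[OF z V(2)] endomorphismD(3)[OF f z V(2)] colf by (simp add: u_def)
    qed
    then show "k z = (f \<otimes>\<^bsub>M\<^esub> restrict u (verts B)) z"
      using z endomorphismD(1)[OF f z] by (simp add: mult_End compose_def)
  qed
  with uM show ?thesis by blast
qed

section \<open>Counting the classes\<close>

text \<open>Constant choices of copy numbers already separate infinitely many L-classes. For an
  infinite image, the choices of 0 or 1 at each image vertex correspond to the sets of natural
  numbers.\<close>

lemma L_classes_infinite:
  assumes f: "regular_element M f"
  shows "(UNIV :: nat set) \<lesssim> L_classes_in M (D_class M f)"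
    and "infinite (f ` verts B) \<Longrightarrow> (UNIV :: nat set set) \<lesssim> L_classes_in M (D_class M f)"
proof -
  have fM: "f \<in> carrier M" using f unfolding regular_element_def by blast
  obtain x y where "(x, y) \<in> edges B" by (rule ex_edge)
  then have fx: "f x \<in> f ` verts B" using edges_verts by blast
  obtain k :: "('v \<Rightarrow> nat) \<Rightarrow> 'v \<Rightarrow> 'v" where k: "\<And>s. (f, k s) \<in> green_R M"
    "\<And>s t y. (k s, k t) \<in> green_L M \<Longrightarrow> y \<in> f ` verts B \<Longrightarrow> s y = t y"
    by (rule regular_D_class_families[OF f fx fx refl]) blast
  show "(UNIV :: nat set) \<lesssim> L_classes_in M (D_class M f)"
    using k(2)[OF _ fx] by (intro lepoll_L_classes_in_D_class[OF fM, of _ "\<lambda>n. k (\<lambda>_. n)"] k(1)) blast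
  show "(UNIV :: nat set set) \<lesssim> L_classes_in M (D_class M f)" if inf: "infinite (f ` verts B)"
  proof -
    have cnt: "countable (f ` verts B)" using countable_verts by simp
    define s where "s X = (\<lambda>y. if to_nat_on (f ` verts B) y \<in> X then 1 else 0 :: nat)" for X
    show ?thesis
    proof (rule lepoll_L_classes_in_D_class[OF fM, of _ "\<lambda>X. k (s X)"])
      fix X Y assume "(k (s X), k (s Y)) \<in> green_L M"
      then have eq: "s X y = s Y y" if "y \<in> f ` verts B" for y using k(2) that by blast
      show "X = Y"
      proof (rule Set.set_eqI)
        fix n
        have "to_nat_on (f ` verts B) (from_nat_into (f ` verts B) n) = n"
          using cnt inf by (rule to_nat_on_from_nat_into_infinite)
        moreover have "from_nat_into (f ` verts B) n \<in> f ` verts B"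
          using fx by (intro from_nat_into) blast
        ultimately show "n \<in> X \<longleftrightarrow> n \<in> Y" using eq unfolding s_def by (metis zero_neq_one)
      qed
    qed (rule k(1))
  qed
qed

text \<open>An image that is not a single edge contains two distinct vertices of the same colour,
  and these serve as the two values that make the kernels of the maps \<open>h X\<close>
  differ.\<close>

lemma R_classes_continuum:
  assumes f: "regular_element M f" and nK: "\<not> bisomorphic (bimage B f) K11"
  shows "R_classes_in M (D_class M f) \<approx> (UNIV :: nat set set)"
proof (rule lepoll_antisym)
  show "R_classes_in M (D_class M f) \<lesssim> (UNIV :: nat set set)"
    using R_classes_in_lepoll_carrier endomorphisms_lepoll_continuum by (rule lepoll_trans)
  have fM: "f \<in> carrier M" using f unfolding regular_element_def by blast
  obtain a a' where a: "a \<in> f ` verts B" "a' \<in> f ` verts B" "c a = c a'" "a \<noteq> a'"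
    using bimage_iso_K11I[OF fM] nK by blast
  obtain h :: "nat set \<Rightarrow> 'v \<Rightarrow> 'v" where h: "\<And>X. (f, h X) \<in> green_L M"
    "\<And>X Y. (h X, h Y) \<in> green_R M \<Longrightarrow> a \<noteq> a' \<Longrightarrow> X = Y"
    by (rule regular_D_class_families[OF f a(1-3)]) blast
  show "(UNIV :: nat set set) \<lesssim> R_classes_in M (D_class M f)"
    using h(2) a(4) by (intro lepoll_R_classes_in_D_class[OF fM, of _ h] h(1)) blast
qed

lemma L_classes_countably_infinite:
  assumes f: "regular_element M f" and fin: "finite (f ` verts B)"
  shows "L_classes_in M (D_class M f) \<approx> (UNIV :: nat set)"
proof (rule lepoll_antisym)
  have fM: "f \<in> carrier M" using f unfolding regular_element_def by blast
  have "countable (L_classes_in M (D_class M f))"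
    unfolding L_classes_in_D_class[OF fM] using countable_green_R_of_finite_image[OF fin] by simp
  then show "L_classes_in M (D_class M f) \<lesssim> (UNIV :: nat set)"
    unfolding lepoll_def countable_def by blast
qed (rule L_classes_infinite(1)[OF f])

text \<open>A map in the L-class of \<open>f\<close> has its values in the same two vertices, so it
  and \<open>f\<close> are right multiples of each other. The whole L-class of \<open>f\<close> thus
  lies in its R-class, which leaves no other R-class in the D-class.\<close>

lemma R_classes_K11:
  assumes fM: "f \<in> carrier M" and iso: "bisomorphic (bimage B f) K11"
  shows "card (R_classes_in M (D_class M f)) = 1"
proof -
  obtain p q where pq: "f ` verts B = {p, q}" "c p \<noteq> c q" by (rule bimage_iso_K11D[OF fM iso])
  have "(f, k) \<in> green_R M" if fk: "(f, k) \<in> green_L M" for k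
  proof -
    obtain m where kM: "k \<in> carrier M" and m: "m \<in> carrier M" "k = m \<otimes>\<^bsub>M\<^esub> f"
      using fk unfolding green_L_iff by blast
    have "k ` verts B \<subseteq> {p, q}"
      unfolding pq(1)[symmetric] m(2) using endomorphismD(1)[OF m(1)] by (auto simp: mult_End compose_def)
    then show ?thesis
      using two_vertex_image_right_multiple[of f k p q] two_vertex_image_right_multiple[of k f p q]
        pq fM kM unfolding green_R_iff by blast
  qed
  then have "green_R M `` {k} = green_R M `` {f}" if "(f, k) \<in> green_L M" for k
    using equiv_class_eq[OF equiv_green_R] that by blast
  moreover have "(f, f) \<in> green_L M" using fM by (simp add: green_L_def)
  ultimately have "R_classes_in M (D_class M f) = {green_R M `` {f}}"
    unfolding R_classes_in_D_class[OF fM] by blast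
  then show ?thesis by simp
qed

end

theorem theorem5p9:
  fixes B :: "'v bstruct" and f :: "'v \<Rightarrow> 'v"
  assumes "universal_bipartite_graph B"
    and "regular_element (End_monoid B) f"
  shows "(infinite (verts (bimage B f)) \<longrightarrow>
            L_classes_in (End_monoid B) (D_class (End_monoid B) f) \<approx> (UNIV :: nat set set) \<and>
            R_classes_in (End_monoid B) (D_class (End_monoid B) f) \<approx> (UNIV :: nat set set)) \<and>
         (finite (verts (bimage B f)) \<and> \<not> bisomorphic (bimage B f) K11 \<longrightarrow>
            L_classes_in (End_monoid B) (D_class (End_monoid B) f) \<approx> (UNIV :: nat set) \<and>
            R_classes_in (End_monoid B) (D_class (End_monoid B) f) \<approx> (UNIV :: nat set set)) \<and>
         (bisomorphic (bimage B f) K11 \<longrightarrow>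
            L_classes_in (End_monoid B) (D_class (End_monoid B) f) \<approx> (UNIV :: nat set) \<and>
            card (R_classes_in (End_monoid B) (D_class (End_monoid B) f)) = 1)"
proof -
  obtain c where "generic_bipartite B c"
    using assms(1) by (rule universal_bipartite_graph_imp_generic)
  then interpret generic_bipartite B c .
  note f = assms(2)
  have fM: "f \<in> carrier M" using f unfolding regular_element_def by blast
  have V: "verts (bimage B f) = f ` verts B" by (simp add: bimage_def)
  \<comment> \<open>A single edge is a finite image, so the third case takes its number of L-classes
    from the finite case.\<close>
  have fin: "finite (f ` verts B)" if "bisomorphic (bimage B f) K11"
    using bimage_iso_K11D[OF fM that] by (metis finite.emptyI finite.insertI)
  have "L_classes_in M (D_class M f) \<approx> (UNIV :: nat set set)" if "infinite (f ` verts B)"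
    using lepoll_trans[OF L_classes_in_lepoll_carrier endomorphisms_lepoll_continuum]
      L_classes_infinite(2)[OF f that] by (rule lepoll_antisym)
  then show ?thesis
    unfolding V
    using fin R_classes_continuum[OF f] L_classes_countably_infinite[OF f] R_classes_K11[OF fM]
    by blast
qed

end
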